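(* Let $\mathbf{K}=\bigcup_n\mathbf{A}_n$ be a Fraïssé structure with fixed exhaustion such that every $\mathbf{A}_n$ has finite big Ramsey degree $R_n$, let $G=\mathrm{Aut}(\mathbf{K})$, and let $\mathcal{K}=\{\mathbf{A}:\mathbf{A}\cong\mathbf{A}_n\text{ for some }n\}$. Assume $G$ is Roelcke precompact, and let $\mathcal{K}'$ be the big Ramsey expansion of $\mathcal{K}$. Then $\mathcal{K}'$ has the Amalgamation Property: whenever $\mathbf{A}',\mathbf{B}',\mathbf{C}'\in\mathcal{K}'$ and $f:\mathbf{A}'\to\mathbf{B}'$, $g:\mathbf{A}'\to\mathbf{C}'$ are embeddings, there are $\mathbf{D}'\in\mathcal{K}'$ and embeddings $r:\mathbf{B}'\to\mathbf{D}'$, $s:\mathbf{C}'\to\mathbf{D}'$ with $r\circ f=s\circ g$.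
   Context: $G=\mathrm{Aut}(\mathbf{K})$ carries the pointwise convergence topology; it is Roelcke precompact if for every open $U\ni 1_G$ there is a finite $F\subseteq G$ with $UFU=G$. Fraïssé: countable, every embedding of a finite substructure into $\mathbf{K}$ extends to an automorphism. Exhaustion: finite substructures $\emptyset=\mathbf{A}_0\subseteq\mathbf{A}_1\subseteq\cdots$ with union $\mathbf{K}$; $H_m=\mathrm{Emb}(\mathbf{A}_m,\mathbf{K})$, $H_m^n=\mathrm{Emb}(\mathbf{A}_m,\mathbf{A}_n)$, $\widehat G=\mathrm{Emb}(\mathbf{K},\mathbf{K})$. $\mathbf{B}\cdot f$ denotes the structure on the domain of an injection $f$ making $f$ an embedding into $\mathbf{B}$. Big Ramsey degree of $\mathbf{A}_n$: least $\ell$ such that for every $r>\ell$ and every $\gamma:H_n\to r$ there is $\eta\in\widehat G$ with $|\{\gamma(\eta\circ f):f\in H_n\}|\le\ell$. A set $S\subseteq H_m$ is unavoidable if $\{f\in H_m:\eta\circ f\in S\}\neq\emptyset$ for all $\eta\in\widehat G$; an unavoidable $k$-coloring of $H_m$ is a map from $H_m$ to a finite set with image of size $k$ and all nonempty fibers unavoidable. For colorings $\gamma$ of $H_m$, $\delta$ of $H_n$ ($m\le n$), $\gamma\ll\delta$ means $\delta(s_0)=\delta(s_1)\Rightarrow\gamma(s_0\circ f)=\gamma(s_1\circ f)$ for all $f\in H_m^n$, $s_0,s_1\in H_n$. An expansion of $\mathcal{K}$ is a class $\mathcal{K}^*$ of $L^*$-structures ($L^*\supseteq L$) with $\mathbf{A}^*|_L\in\mathcal{K}$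 for all $\mathbf{A}^*\in\mathcal{K}^*$, every $\mathbf{A}\in\mathcal{K}$ having at least one expansion in $\mathcal{K}^*$ (set $\mathcal{K}^*(\mathbf{A})$), and $\mathbf{B}^*\cdot f\in\mathcal{K}^*(\mathbf{A})$ whenever $\mathbf{A}\in\mathcal{K}$, $\mathbf{B}^*\in\mathcal{K}^*$, $f:\mathbf{A}\to\mathbf{B}^*|_L$ an embedding. Precompact: each $\mathcal{K}^*(\mathbf{A})$ finite. Reasonable: for each embedding $f:\mathbf{A}\to\mathbf{B}$ in $\mathcal{K}$, $\mathbf{B}^*\mapsto\mathbf{B}^*\cdot f$ maps $\mathcal{K}^*(\mathbf{B})$ onto $\mathcal{K}^*(\mathbf{A})$. The big Ramsey expansion of $\mathcal{K}$ is a reasonable precompact expansion $\mathcal{K}'$ such that for every $r<\omega$ there are unavoidable $R_n$-colorings $\gamma_n$ of $H_n$ ($n<r$) with $\gamma_m\ll\gamma_n$ for $m\le n<r$ and bijections $\sigma_n:\mathrm{im}(\gamma_n)\to\mathcal{K}'(\mathbf{A}_n)$ with $\sigma_m(\gamma_m(s\circ f))=\sigma_n(\gamma_n(s))\cdot f$ for all $m\le n<r$, $s\in H_n$, $f\in H_m^n$ (it exists and is unique up to isomorphism of expansions). *)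

theory Defs
  imports "HOL-Analysis.Function_Topology" "HOL-Algebra.Bij" "HOL-Algebra.Coset"
begin

section \<open>Relational structures and embeddings\<close>

text \<open>
  A relational language is a partial map sending each of its symbols to its arity; sublanguage
  is the order on partial maps.  The language is relational because the pullback of a structure
  along an arbitrary injection has to be a structure, and the empty set has to carry a substructure.
  Relations are sets of tuples, encoded as lists.  Symbols outside the language are
  interpreted by the empty set, so that two structures for the same language are equal as
  mathematical objects iff they are equal as records.
\<close>

type_synonym 's language = "'s \<rightharpoonup> nat"

record ('a, 's) fo_struct =
  univ :: "'a set"
  interp :: "'s \<Rightarrow> 'a list set"

definition is_structure :: "'s language \<Rightarrow> ('a, 's) fo_struct \<Rightarrow> bool" where
  "is_structure L A \<longleftrightarrow>
     (\<forall>R. case L R of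
            None \<Rightarrow> interp A R = {}
          | Some k \<Rightarrow> interp A R \<subseteq> {xs \<in> lists (univ A). length xs = k})"

definition reduct :: "'s language \<Rightarrow> ('a, 's) fo_struct \<Rightarrow> ('a, 's) fo_struct" where
  "reduct L A = \<lparr>univ = univ A, interp = (\<lambda>R. if R \<in> dom L then interp A R else {})\<rparr>"

definition substructure :: "('a, 's) fo_struct \<Rightarrow> ('a, 's) fo_struct \<Rightarrow> bool" where
  "substructure A B \<longleftrightarrow>
     univ A \<subseteq> univ B \<and> (\<forall>R. interp A R = interp B R \<inter> lists (univ A))"

text \<open>
  Maps between structures are extensional functions (constantly \<open>undefined\<close> off the domain), so
  that the set of embeddings is the set of embeddings as partial maps; composition of maps is
  accordingly \<open>compose\<close>.  Both structures are meant to be structures for the same language.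
\<close>

definition Emb :: "('a, 's) fo_struct \<Rightarrow> ('a, 's) fo_struct \<Rightarrow> ('a \<Rightarrow> 'a) set" where
  "Emb A B = {f \<in> univ A \<rightarrow>\<^sub>E univ B. inj_on f (univ A) \<and>
     (\<forall>R. \<forall>xs \<in> lists (univ A). xs \<in> interp A R \<longleftrightarrow> map f xs \<in> interp B R)}"

definition isomorphic :: "('a, 's) fo_struct \<Rightarrow> ('a, 's) fo_struct \<Rightarrow> bool" where
  "isomorphic A B \<longleftrightarrow> (\<exists>f \<in> Emb A B. f ` univ A = univ B)"

definition Aut :: "('a, 's) fo_struct \<Rightarrow> ('a \<Rightarrow> 'a) set" where
  "Aut K = {g \<in> Emb K K. g ` univ K = univ K}"

text \<open>\<open>pullback X B f\<close> is the structure \<open>B \<cdot> f\<close> for an injection \<open>f\<close> with domain \<open>X\<close>.\<close>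

definition pullback :: "'a set \<Rightarrow> ('a, 's) fo_struct \<Rightarrow> ('a \<Rightarrow> 'a) \<Rightarrow> ('a, 's) fo_struct" where
  "pullback X B f = \<lparr>univ = X, interp = (\<lambda>R. {xs \<in> lists X. map f xs \<in> interp B R})\<rparr>"

definition Fraisse_structure :: "'s language \<Rightarrow> ('a, 's) fo_struct \<Rightarrow> bool" where
  "Fraisse_structure L K \<longleftrightarrow> is_structure L K \<and> countable (univ K) \<and>
     (\<forall>A. substructure A K \<and> finite (univ A) \<longrightarrow>
        (\<forall>f \<in> Emb A K. \<exists>g \<in> Aut K. \<forall>x \<in> univ A. g x = f x))"

definition exhaustion :: "('a, 's) fo_struct \<Rightarrow> (nat \<Rightarrow> ('a, 's) fo_struct) \<Rightarrow> bool" where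
  "exhaustion K A \<longleftrightarrow> univ (A 0) = {} \<and>
     (\<forall>n. substructure (A n) K \<and> finite (univ (A n)) \<and> substructure (A n) (A (Suc n))) \<and>
     (\<Union>n. univ (A n)) = univ K"

text \<open>
  Classes of structures are sets of structures whose universes are subsets of the type \<open>'a\<close>
  that also carries \<open>K\<close>; every isomorphism type below is represented there.
\<close>

definition iso_closure ::
    "'s language \<Rightarrow> (nat \<Rightarrow> ('a, 's) fo_struct) \<Rightarrow> ('a, 's) fo_struct set" where
  "iso_closure L A = {B. is_structure L B \<and> (\<exists>n. isomorphic B (A n))}"

definition amalgamation_property :: "('a, 's) fo_struct set \<Rightarrow> bool" where
  "amalgamation_property \<C> \<longleftrightarrow>
     (\<forall>A \<in> \<C>. \<forall>B \<in> \<C>. \<forall>C \<in> \<C>. \<forall>f \<in> Emb A B. \<forall>g \<in> Emb A C.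
        \<exists>D \<in> \<C>. \<exists>r \<in> Emb B D. \<exists>s \<in> Emb C D.
          compose (univ A) r f = compose (univ A) s g)"

section \<open>The automorphism group and Roelcke precompactness\<close>

definition aut_group :: "('a, 's) fo_struct \<Rightarrow> ('a \<Rightarrow> 'a) monoid" where
  "aut_group K = (BijGroup (univ K))\<lparr>carrier := Aut K\<rparr>"

definition pointwise_topology :: "('a, 's) fo_struct \<Rightarrow> ('a \<Rightarrow> 'a) topology" where
  "pointwise_topology K =
     subtopology (product_topology (\<lambda>_. discrete_topology (univ K)) (univ K)) (Aut K)"

definition Roelcke_precompact :: "('g, 'b) monoid_scheme \<Rightarrow> 'g topology \<Rightarrow> bool" where
  "Roelcke_precompact G T \<longleftrightarrow>
     (\<forall>U. openin T U \<and> \<one>\<^bsub>G\<^esub> \<in> U \<longrightarrow>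
        (\<exists>F \<subseteq> carrier G. finite F \<and> U <#>\<^bsub>G\<^esub> F <#>\<^bsub>G\<^esub> U = carrier G))"

section \<open>Big Ramsey degrees and unavoidable colorings\<close>

definition big_Ramsey_bound ::
    "('a, 's) fo_struct \<Rightarrow> ('a, 's) fo_struct \<Rightarrow> nat \<Rightarrow> bool" where
  "big_Ramsey_bound K A l \<longleftrightarrow>
     (\<forall>r > l. \<forall>\<gamma> \<in> Emb A K \<rightarrow> {..<r}. \<exists>\<eta> \<in> Emb K K.
        card {\<gamma> (compose (univ A) \<eta> f) | f. f \<in> Emb A K} \<le> l)"

definition has_big_Ramsey_degree ::
    "('a, 's) fo_struct \<Rightarrow> ('a, 's) fo_struct \<Rightarrow> nat \<Rightarrow> bool" where
  "has_big_Ramsey_degree K A l \<longleftrightarrow>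
     big_Ramsey_bound K A l \<and> (\<forall>k. big_Ramsey_bound K A k \<longrightarrow> l \<le> k)"

definition unavoidable ::
    "('a, 's) fo_struct \<Rightarrow> ('a, 's) fo_struct \<Rightarrow> ('a \<Rightarrow> 'a) set \<Rightarrow> bool" where
  "unavoidable K A S \<longleftrightarrow> S \<subseteq> Emb A K \<and>
     (\<forall>\<eta> \<in> Emb K K. {f \<in> Emb A K. compose (univ A) \<eta> f \<in> S} \<noteq> {})"

definition unavoidable_coloring ::
    "('a, 's) fo_struct \<Rightarrow> ('a, 's) fo_struct \<Rightarrow> nat \<Rightarrow> (('a \<Rightarrow> 'a) \<Rightarrow> 'c) \<Rightarrow> bool" where
  "unavoidable_coloring K A k \<gamma> \<longleftrightarrow> finite (\<gamma> ` Emb A K) \<and> card (\<gamma> ` Emb A K) = k \<and>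
     (\<forall>c \<in> \<gamma> ` Emb A K. unavoidable K A {s \<in> Emb A K. \<gamma> s = c})"

text \<open>\<open>coloring_le K A B \<gamma> \<delta>\<close> is \<open>\<gamma> \<lless> \<delta>\<close> for colorings \<open>\<gamma>\<close> of \<open>Emb A K\<close> and \<open>\<delta>\<close> of \<open>Emb B K\<close>.\<close>

definition coloring_le ::
    "('a, 's) fo_struct \<Rightarrow> ('a, 's) fo_struct \<Rightarrow> ('a, 's) fo_struct \<Rightarrow>
     (('a \<Rightarrow> 'a) \<Rightarrow> 'c) \<Rightarrow> (('a \<Rightarrow> 'a) \<Rightarrow> 'd) \<Rightarrow> bool" where
  "coloring_le K A B \<gamma> \<delta> \<longleftrightarrow>
     (\<forall>f \<in> Emb A B. \<forall>s\<^sub>0 \<in> Emb B K. \<forall>s\<^sub>1 \<in> Emb B K.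
        \<delta> s\<^sub>0 = \<delta> s\<^sub>1 \<longrightarrow> \<gamma> (compose (univ A) s\<^sub>0 f) = \<gamma> (compose (univ A) s\<^sub>1 f))"

section \<open>Expansions\<close>

definition expansions_of ::
    "'s language \<Rightarrow> ('a, 's) fo_struct set \<Rightarrow> ('a, 's) fo_struct \<Rightarrow> ('a, 's) fo_struct set" where
  "expansions_of L \<K>' A = {A' \<in> \<K>'. reduct L A' = A}"

definition expansion_class ::
    "'s language \<Rightarrow> 's language \<Rightarrow> ('a, 's) fo_struct set \<Rightarrow> ('a, 's) fo_struct set \<Rightarrow> bool" where
  "expansion_class L L' \<K> \<K>' \<longleftrightarrow> L \<subseteq>\<^sub>m L' \<and>
     (\<forall>A' \<in> \<K>'. is_structure L' A' \<and> reduct L A' \<in> \<K>) \<and>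
     (\<forall>A \<in> \<K>. expansions_of L \<K>' A \<noteq> {}) \<and>
     (\<forall>A \<in> \<K>. \<forall>B' \<in> \<K>'. \<forall>f \<in> Emb A (reduct L B').
        pullback (univ A) B' f \<in> expansions_of L \<K>' A)"

definition precompact_expansion ::
    "'s language \<Rightarrow> ('a, 's) fo_struct set \<Rightarrow> ('a, 's) fo_struct set \<Rightarrow> bool" where
  "precompact_expansion L \<K> \<K>' \<longleftrightarrow> (\<forall>A \<in> \<K>. finite (expansions_of L \<K>' A))"

definition reasonable_expansion ::
    "'s language \<Rightarrow> ('a, 's) fo_struct set \<Rightarrow> ('a, 's) fo_struct set \<Rightarrow> bool" where
  "reasonable_expansion L \<K> \<K>' \<longleftrightarrow>
     (\<forall>A \<in> \<K>. \<forall>B \<in> \<K>. \<forall>f \<in> Emb A B.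
        (\<lambda>B'. pullback (univ A) B' f) ` expansions_of L \<K>' B = expansions_of L \<K>' A)"

text \<open>
  The colorings and bijections may depend on \<open>r\<close>.  Colors are natural numbers; since each coloring
  has finite image this is no restriction.
\<close>

definition big_Ramsey_expansion ::
    "'s language \<Rightarrow> 's language \<Rightarrow> ('a, 's) fo_struct \<Rightarrow> (nat \<Rightarrow> ('a, 's) fo_struct) \<Rightarrow>
     (nat \<Rightarrow> nat) \<Rightarrow> ('a, 's) fo_struct set \<Rightarrow> bool" where
  "big_Ramsey_expansion L L' K A R \<K>' \<longleftrightarrow>
     expansion_class L L' (iso_closure L A) \<K>' \<and>
     precompact_expansion L (iso_closure L A) \<K>' \<and>
     reasonable_expansion L (iso_closure L A) \<K>' \<and>
     (\<forall>r. \<exists>(\<gamma> :: nat \<Rightarrow> ('a \<Rightarrow> 'a) \<Rightarrow> nat) (\<sigma> :: nat \<Rightarrow> nat \<Rightarrow> ('a, 's) fo_struct).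
        (\<forall>n < r. unavoidable_coloring K (A n) (R n) (\<gamma> n)) \<and>
        (\<forall>n < r. \<forall>m \<le> n. coloring_le K (A m) (A n) (\<gamma> m) (\<gamma> n)) \<and>
        (\<forall>n < r. bij_betw (\<sigma> n) (\<gamma> n ` Emb (A n) K) (expansions_of L \<K>' (A n))) \<and>
        (\<forall>n < r. \<forall>m \<le> n. \<forall>s \<in> Emb (A n) K. \<forall>f \<in> Emb (A m) (A n).
           \<sigma> m (\<gamma> m (compose (univ (A m)) s f)) = pullback (univ (A m)) (\<sigma> n (\<gamma> n s)) f))"

end

theory Submission
  imports Defs
begin

text \<open>
  Reasonableness reduces the problem to amalgamating two expansions of \<open>A n\<close> over \<open>A m\<close>.
  By Roelcke precompactness there are, up to automorphisms, only finitely many pairs of embeddings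
  of \<open>A n\<close> into \<open>K\<close>, so all of them are visible inside one \<open>A N\<close>; it therefore suffices to find
  embeddings \<open>s\<close>, \<open>t\<close> of the two prescribed colors with \<open>s \<circ> f = t \<circ> g\<close>.  If there are none, then
  the embeddings \<open>s \<circ> f\<close> with \<open>s\<close> of the first color split one color class of the unavoidable
  coloring of \<open>Emb (A m) K\<close> in two unavoidable parts, one color more than the big Ramsey
  degree allows.
\<close>

section \<open>Embeddings, reducts and pullbacks of structures\<close>

lemma map_in_lists: "f \<in> X \<rightarrow> Y \<Longrightarrow> xs \<in> lists X \<Longrightarrow> map f xs \<in> lists Y"
  by (induction xs) auto

lemma EmbD:
  assumes "f \<in> Emb A B"
  shows "f \<in> univ A \<rightarrow> univ B" "f \<in> extensional (univ A)" "inj_on f (univ A)"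
    "xs \<in> lists (univ A) \<Longrightarrow> xs \<in> interp A R \<longleftrightarrow> map f xs \<in> interp B R"
  using assms by (auto simp: Emb_def PiE_def)

lemma Emb_compose:
  assumes "f \<in> Emb A B" "g \<in> Emb B C"
  shows "compose (univ A) g f \<in> Emb A C"
proof -
  have f: "f \<in> univ A \<rightarrow> univ B" "inj_on f (univ A)"
    and g: "g \<in> univ B \<rightarrow> univ C" "inj_on g (univ B)"
    using assms by (auto simp: Emb_def PiE_def)
  have "map f xs \<in> lists (univ B)" if "xs \<in> lists (univ A)" for xs
    using map_in_lists[OF f(1) that] .
  moreover have "map (compose (univ A) g f) xs = map g (map f xs)" if "xs \<in> lists (univ A)" for xs
    using that by (auto simp: compose_def)
  moreover have "inj_on (compose (univ A) g f) (univ A)"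
    using f g unfolding inj_on_def compose_def by (auto simp: Pi_iff)
  moreover have "compose (univ A) g f \<in> univ A \<rightarrow>\<^sub>E univ C"
    using f g by (auto simp: compose_def)
  ultimately show ?thesis
    using assms unfolding Emb_def by (simp del: map_map map_eq_conv)
qed

lemma Emb_restrict:
  assumes "substructure A B" "f \<in> Emb B C"
  shows "restrict f (univ A) \<in> Emb A C"
proof -
  have sub: "univ A \<subseteq> univ B" and int: "\<And>R. interp A R = interp B R \<inter> lists (univ A)"
    using assms(1) by (auto simp: substructure_def)
  have "map (restrict f (univ A)) xs = map f xs" if "xs \<in> lists (univ A)" for xs
    using that by auto
  moreover have "xs \<in> lists (univ B)" if "xs \<in> lists (univ A)" for xs
    using that sub by auto
  moreover have "inj_on (restrict f (univ A)) (univ A)"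
    using inj_on_subset[OF EmbD(3)[OF assms(2)] sub] by simp
  moreover have "restrict f (univ A) \<in> univ A \<rightarrow>\<^sub>E univ C"
    using assms(2) sub unfolding Emb_def by auto
  ultimately show ?thesis
    using assms(2) int unfolding Emb_def by (simp del: map_map map_eq_conv)
qed

lemma Emb_corestrict:
  assumes "f \<in> Emb A C" "substructure B C" "f ` univ A \<subseteq> univ B"
  shows "f \<in> Emb A B"
proof -
  have f: "f \<in> univ A \<rightarrow> univ B" using assms(3) by blast
  show ?thesis
    using assms f map_in_lists[OF f] unfolding Emb_def substructure_def by (simp add: PiE_def)
qed

lemma Emb_substructure_trans:
  assumes "f \<in> Emb A B" "substructure B C"
  shows "f \<in> Emb A C"
proof -
  have "map f xs \<in> lists (univ B)" if "xs \<in> lists (univ A)" for xs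
    using map_in_lists[OF EmbD(1)[OF assms(1)] that] .
  then show ?thesis
    using assms unfolding Emb_def substructure_def by (auto simp: PiE_def)
qed

lemma Emb_id: "(\<lambda>x\<in>univ A. x) \<in> Emb A A"
proof -
  have "map (\<lambda>x\<in>univ A. x) xs = xs" if "xs \<in> lists (univ A)" for xs
    using that by (induction xs) auto
  then show ?thesis
    unfolding Emb_def by (auto simp: inj_on_def)
qed

text \<open>A tuple \<open>ys\<close> over \<open>B\<close> is the \<open>f\<close>-image of
  \<open>map ?h ys\<close>, so the embedding condition of \<open>f\<close> at that tuple, read
  backwards, is the one for the inverse.\<close>

lemma Emb_inv:
  assumes "f \<in> Emb A B" "f ` univ A = univ B"
  shows "restrict (inv_into (univ A) f) (univ B) \<in> Emb B A"
    (is "?h \<in> _")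
proof -
  have h: "?h y \<in> univ A" "f (?h y) = y" if "y \<in> univ B" for y
    using that assms(2) by (auto simp: inv_into_into f_inv_into_f)
  have fh: "map f (map ?h ys) = ys" if "ys \<in> lists (univ B)" for ys
    using that h by (induction ys) auto
  have h_lists: "map ?h ys \<in> lists (univ A)" if "ys \<in> lists (univ B)" for ys
    using that h by (induction ys) auto
  have "ys \<in> interp B R \<longleftrightarrow> map ?h ys \<in> interp A R" if "ys \<in> lists (univ B)" for ys R
    using EmbD(4)[OF assms(1) h_lists[OF that], of R] unfolding fh[OF that] by (rule sym)
  moreover have "inj_on ?h (univ B)"
    using h(2) by (metis inj_onI)
  moreover have "?h \<in> univ B \<rightarrow>\<^sub>E univ A"
    using h(1) by auto
  ultimately show ?thesis
    unfolding Emb_def by blast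
qed

lemma Emb_reduct:
  assumes "f \<in> Emb A B"
  shows "f \<in> Emb (reduct L A) (reduct L B)"
  using assms unfolding Emb_def reduct_def by auto

text \<open>The relations of a structure contain only tuples over its universe, so the embedding
  condition determines them completely. Together with \<open>Emb_pullback\<close> this lets
  embeddings be handled as equations between pullbacks.\<close>

lemma pullback_Emb_eq:
  assumes "is_structure L A" "f \<in> Emb A B"
  shows "pullback (univ A) B f = A"
proof -
  have "interp A R \<subseteq> lists (univ A)" for R
    using assms(1) unfolding is_structure_def by (auto split: option.splits dest: spec[of _ R])
  then have "{xs \<in> lists (univ A). map f xs \<in> interp B R} = interp A R" for R
    using EmbD(4)[OF assms(2)] by blast
  then show ?thesis
    unfolding pullback_def by simp
qed

lemma Emb_pullback:
  assumes "f \<in> univ A \<rightarrow>\<^sub>E univ B" "inj_on f (univ A)" "pullback (univ A) B f = A"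
  shows "f \<in> Emb A B"
proof -
  have "interp A R = {xs \<in> lists (univ A). map f xs \<in> interp B R}" for R
    using arg_cong[OF assms(3), of "\<lambda>S. interp S R"] by (simp add: pullback_def)
  then show ?thesis
    using assms(1,2) unfolding Emb_def by auto
qed

lemma pullback_compose:
  assumes "f \<in> X \<rightarrow> Y"
  shows "pullback X (pullback Y B g) f = pullback X B (compose X g f)"
proof -
  have "xs \<in> lists X \<Longrightarrow> map f xs \<in> lists Y" for xs
    by (rule map_in_lists[OF assms])
  moreover have "xs \<in> lists X \<Longrightarrow> map (compose X g f) xs = map g (map f xs)" for xs
    by (auto simp: compose_def)
  ultimately have "{xs \<in> lists X. map f xs \<in> {ys \<in> lists Y. map g ys \<in> interp B R}}
      = {xs \<in> lists X. map (compose X g f) xs \<in> interp B R}" for R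
    by (metis (no_types, lifting) mem_Collect_eq)
  then show ?thesis
    by (simp add: pullback_def)
qed

section \<open>Exhaustions by finite substructures\<close>

lemma exhaustion_mono:
  assumes "exhaustion K A" "m \<le> n"
  shows "substructure (A m) (A n)"
proof -
  have sub: "substructure (A m) K" "substructure (A n) K"
    and "\<And>i. univ (A i) \<subseteq> univ (A (Suc i))"
    using assms(1) by (auto simp: exhaustion_def substructure_def)
  then have le: "univ (A m) \<subseteq> univ (A n)"
    using lift_Suc_mono_le[of "\<lambda>i. univ (A i)"] assms(2) by blast
  then have "lists (univ (A m)) \<subseteq> lists (univ (A n))"
    by (rule lists_mono)
  then show ?thesis
    using sub le unfolding substructure_def by blast
qed

text \<open>The lower bound \<open>n\<close> is a parameter so that the stage found can also be made
  to contain a given stage \<open>A n\<close>.\<close>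

lemma exhaustion_finite_subset:
  assumes "exhaustion K A" "finite S" "S \<subseteq> univ K"
  shows "\<exists>N\<ge>n. S \<subseteq> univ (A N)"
  using assms(2,3)
proof (induction S)
  case (insert x S)
  then obtain N where N: "N \<ge> n" "S \<subseteq> univ (A N)" by auto
  have "x \<in> (\<Union>n. univ (A n))"
    using insert.prems assms(1) unfolding exhaustion_def by simp
  then obtain M where "x \<in> univ (A M)" by blast
  then have "insert x S \<subseteq> univ (A (max M N))"
    using N exhaustion_mono[OF assms(1), of M "max M N"] exhaustion_mono[OF assms(1), of N "max M N"]
    unfolding substructure_def by auto
  then show ?case
    using N by (meson le_trans max.cobounded2)
qed auto

lemma substructure_in_iso_closure:
  assumes "is_structure L K" "exhaustion K A"
  shows "A n \<in> iso_closure L A"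
proof -
  have "interp (A n) R = interp K R \<inter> lists (univ (A n))" for R
    using assms(2) unfolding exhaustion_def substructure_def by blast
  then have "is_structure L (A n)"
    using assms(1) unfolding is_structure_def by (fastforce split: option.splits)
  moreover have "isomorphic (A n) (A n)"
    unfolding isomorphic_def by (rule bexI[OF _ Emb_id]) auto
  ultimately show ?thesis
    unfolding iso_closure_def by blast
qed

section \<open>Automorphisms and finitely many orbits of pairs of embeddings\<close>

lemma Aut_inv:
  assumes "g \<in> Aut K"
  shows "restrict (inv_into (univ K) g) (univ K) \<in> Aut K"
proof -
  have "inj_on g (univ K)" "g ` univ K = univ K"
    using assms by (auto simp: Aut_def Emb_def)
  then have "inv_into (univ K) g ` univ K = univ K"
    by (metis inv_into_image_cancel subset_refl)
  then show ?thesis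
    using assms Emb_inv[of g K K] by (auto simp: Aut_def)
qed

lemma Aut_subset_Bij: "Aut K \<subseteq> Bij (univ K)"
  by (auto simp: Aut_def Emb_def Bij_def bij_betw_def PiE_def)

text \<open>The stabilizer is the trace on \<open>Aut K\<close> of a basic open box, with a
  singleton factor at each of the finitely many points of \<open>X\<close>.\<close>

lemma openin_pointwise_stabilizer:
  assumes "finite X" "X \<subseteq> univ K"
  shows "openin (pointwise_topology K) {g \<in> Aut K. \<forall>x\<in>X. g x = x}"
proof -
  let ?V = "PiE (univ K) (\<lambda>x. if x \<in> X then {x} else univ K)"
  have "finite {i. (if i \<in> X then {i} else univ K) \<noteq> topspace (discrete_topology (univ K))}"
    by (rule finite_subset[OF _ assms(1)]) auto
  then have "openin (product_topology (\<lambda>_. discrete_topology (univ K)) (univ K)) ?V"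
    using assms(2) by (intro product_topology_basis) auto
  moreover have "g \<in> ?V \<longleftrightarrow> (\<forall>x\<in>X. g x = x)" if "g \<in> Aut K" for g
  proof -
    have "g \<in> extensional (univ K)" "\<forall>x\<in>univ K. g x \<in> univ K"
      using that by (auto simp: Aut_def Emb_def PiE_def)
    then show ?thesis using assms(2) by (auto simp: PiE_iff)
  qed
  then have "{g \<in> Aut K. \<forall>x\<in>X. g x = x} = ?V \<inter> Aut K" by blast
  ultimately show ?thesis
    unfolding pointwise_topology_def openin_subtopology by blast
qed

text \<open>Every pair is a translate of (inclusion, \<phi>) with \<phi> from a finite set. Let
  \<open>U\<close> be the stabilizer of \<open>X\<close> and \<open>U F U = Aut K\<close>. By
  homogeneity \<open>s\<close> extends to \<open>k\<close>, and \<open>k^-1 t\<close> extends to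
  some \<open>g = u \<phi> v\<close> with \<open>u\<close>, \<open>v\<close> in \<open>U\<close>. On
  \<open>X\<close> then \<open>s = k u\<close> and \<open>t = k u \<phi>\<close>.\<close>

lemma Roelcke_precompact_pairs:
  assumes "Fraisse_structure L K"
    and "Roelcke_precompact (aut_group K) (pointwise_topology K)"
    and "substructure X K" "finite (univ X)"
  obtains F where "finite F" "F \<subseteq> Aut K"
    "\<And>s t. s \<in> Emb X K \<Longrightarrow> t \<in> Emb X K \<Longrightarrow>
       \<exists>k \<in> Aut K. \<exists>\<phi> \<in> F. \<forall>x \<in> univ X. s x = k x \<and> t x = k (\<phi> x)"
proof -
  let ?G = "aut_group K"
  define U where "U = {g \<in> Aut K. \<forall>x\<in>univ X. g x = x}"
  have sub: "univ X \<subseteq> univ K"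
    using assms(3) by (simp add: substructure_def)
  have mult: "g \<otimes>\<^bsub>?G\<^esub> h = compose (univ K) g h" if "g \<in> Aut K" "h \<in> Aut K" for g h
    using that Aut_subset_Bij[of K] by (auto simp: aut_group_def BijGroup_def)
  have mult_Aut: "compose (univ K) g h \<in> Aut K" if "g \<in> Aut K" "h \<in> Aut K" for g h
  proof -
    have "compose (univ K) g h ` univ K = g ` h ` univ K"
      by (force simp: compose_def)
    then show ?thesis
      using that Emb_compose[of h K K g K] by (auto simp: Aut_def)
  qed
  have Aut_in: "g x \<in> univ K" if "g \<in> Aut K" "x \<in> univ K" for g x
    using that by (auto simp: Aut_def)
  have "(\<lambda>x\<in>univ K. x) \<in> Aut K"
    using Emb_id[of K] by (auto simp: Aut_def)
  then have "\<one>\<^bsub>?G\<^esub> \<in> U"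
    using sub by (auto simp: U_def aut_group_def BijGroup_def)
  moreover have "openin (pointwise_topology K) U"
    unfolding U_def by (rule openin_pointwise_stabilizer[OF assms(4) sub])
  ultimately obtain F where F: "F \<subseteq> carrier ?G" "finite F" "U <#>\<^bsub>?G\<^esub> F <#>\<^bsub>?G\<^esub> U = carrier ?G"
    using assms(2) unfolding Roelcke_precompact_def by blast
  then have FA: "F \<subseteq> Aut K" by (simp add: aut_group_def)
  have extend: "\<exists>g\<in>Aut K. \<forall>x\<in>univ X. g x = s x" if "s \<in> Emb X K" for s
    using assms(1,3,4) that unfolding Fraisse_structure_def by blast
  have "\<exists>k \<in> Aut K. \<exists>\<phi> \<in> F. \<forall>x \<in> univ X. s x = k x \<and> t x = k (\<phi> x)"
    if s: "s \<in> Emb X K" and t: "t \<in> Emb X K" for s t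
  proof -
    obtain k where k: "k \<in> Aut K" "\<forall>x\<in>univ X. k x = s x" using extend[OF s] by blast
    define k' where "k' = restrict (inv_into (univ K) k) (univ K)"
    have k': "k' \<in> Aut K" unfolding k'_def by (rule Aut_inv[OF k(1)])
    \<comment> \<open>Translating by \<open>k'\<close> makes the first embedding the inclusion and
      leaves only the second one to describe.\<close>
    then have "compose (univ X) k' t \<in> Emb X K"
      using t by (intro Emb_compose) (auto simp: Aut_def)
    then obtain g where g: "g \<in> Aut K" "\<forall>x\<in>univ X. g x = k' (t x)"
      using extend by (force simp: compose_def)
    have "k (k' y) = y" if "y \<in> univ K" for y
      using that k(1) by (auto simp: k'_def Aut_def f_inv_into_f)
    moreover have "t x \<in> univ K" if "x \<in> univ X" for x
      using t that by (auto simp: Emb_def)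
    ultimately have kg: "k (g x) = t x" if "x \<in> univ X" for x
      using g that by simp
    have "g \<in> U <#>\<^bsub>?G\<^esub> F <#>\<^bsub>?G\<^esub> U"
      using g(1) F(3) by (simp add: aut_group_def)
    then obtain u \<phi> v where uv: "u \<in> U" "\<phi> \<in> F" "v \<in> U" "g = (u \<otimes>\<^bsub>?G\<^esub> \<phi>) \<otimes>\<^bsub>?G\<^esub> v"
      unfolding set_mult_def by blast
    then have "u \<in> Aut K" "\<phi> \<in> Aut K" "v \<in> Aut K"
      using FA by (auto simp: U_def)
    then have g_eq: "g = compose (univ K) (compose (univ K) u \<phi>) v"
      using uv(4) mult mult_Aut by simp
    have "g x = u (\<phi> x)" if "x \<in> univ X" for x
      using that sub uv(3) unfolding g_eq by (auto simp: compose_def U_def)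
    \<comment> \<open>The translating automorphism is \<open>k u\<close>: since \<open>u\<close>
      fixes \<open>X\<close> pointwise it still extends \<open>s\<close>, and it absorbs the left
      factor of \<open>g\<close>.\<close>
    then have "\<forall>x\<in>univ X. s x = compose (univ K) k u x \<and> t x = compose (univ K) k u (\<phi> x)"
      using sub k(2) kg uv(1) \<open>\<phi> \<in> Aut K\<close> Aut_in by (auto simp: compose_def U_def subset_iff)
    then show ?thesis
      using mult_Aut[OF k(1) \<open>u \<in> Aut K\<close>] uv(2) by blast
  qed
  then show thesis using that F(2) FA by blast
qed

section \<open>Realizing two prescribed colors by an amalgamating pair\<close>

text \<open>Otherwise give the composites \<open>s \<circ> f\<close>, with \<open>s\<close> of the
  color of \<open>s0\<close>, a fresh color. They all lie in one class of \<gamma>, and the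
  composites \<open>t \<circ> g\<close>, with \<open>t\<close> of the color of \<open>t0\<close>,
  keep the old color of that class. So all \<open>k + 1\<close> colors survive under every
  self-embedding of \<open>K\<close>, against the bound \<open>k\<close>.\<close>

lemma unavoidable_colors_amalgamate:
  assumes \<gamma>: "unavoidable_coloring K X k \<gamma>" and bound: "big_Ramsey_bound K X k"
    and \<delta>: "unavoidable_coloring K Y l \<delta>" and le: "coloring_le K X Y \<gamma> \<delta>"
    and f: "f \<in> Emb X Y" and g: "g \<in> Emb X Y"
    and s0: "s0 \<in> Emb Y K" and t0: "t0 \<in> Emb Y K"
    and eq: "\<gamma> (compose (univ X) s0 f) = \<gamma> (compose (univ X) t0 g)"
  shows "\<exists>s \<in> Emb Y K. \<exists>t \<in> Emb Y K. \<delta> s = \<delta> s0 \<and> \<delta> t = \<delta> t0 \<and>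
           compose (univ X) s f = compose (univ X) t g"
proof (rule ccontr)
  assume none: "\<not> ?thesis"
  define P where "P x \<longleftrightarrow> (\<exists>s\<in>Emb Y K. \<delta> s = \<delta> s0 \<and> compose (univ X) s f = x)" for x
  define a where "a = \<gamma> (compose (univ X) s0 f)"
  have fin: "finite (\<gamma> ` Emb X K)" "card (\<gamma> ` Emb X K) = k"
    using \<gamma> by (auto simp: unavoidable_coloring_def)
  \<comment> \<open>The old colors are renumbered below \<open>k\<close>, which leaves
    \<open>k\<close> itself as the fresh color and makes \<open>Suc k\<close> the number of colors
    of \<epsilon>.\<close>
  then obtain \<beta> where \<beta>: "bij_betw \<beta> (\<gamma> ` Emb X K) {..<k}"
    using ex_bij_betw_finite_nat[of "\<gamma> ` Emb X K"] by (auto simp: atLeast0LessThan)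
  define \<epsilon> where "\<epsilon> x = (if P x then k else \<beta> (\<gamma> x))" for x
  have "\<beta> (\<gamma> x) < k" if "x \<in> Emb X K" for x
    using \<beta> that by (auto simp: bij_betw_def)
  then have \<epsilon>: "\<epsilon> \<in> Emb X K \<rightarrow> {..<Suc k}"
    by (auto simp: \<epsilon>_def less_SucI)
  obtain \<eta> where \<eta>: "\<eta> \<in> Emb K K"
    and card: "card {\<epsilon> (compose (univ X) \<eta> x) |x. x \<in> Emb X K} \<le> k"
    using bound[unfolded big_Ramsey_bound_def, rule_format, OF lessI \<epsilon>] by blast
  let ?E = "{\<epsilon> (compose (univ X) \<eta> x) |x. x \<in> Emb X K}"
  have \<eta>X: "compose (univ X) \<eta> x \<in> Emb X K" if "x \<in> Emb X K" for x
    using Emb_compose[OF that \<eta>] .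
  have \<eta>Y: "compose (univ Y) \<eta> x \<in> Emb Y K" if "x \<in> Emb Y K" for x
    using Emb_compose[OF that \<eta>] .
  have assoc: "compose (univ X) (compose (univ Y) \<eta> s) h = compose (univ X) \<eta> (compose (univ X) s h)"
    if "h \<in> Emb X Y" for s h
    using that by (auto simp: Emb_def compose_def fun_eq_iff)
  \<comment> \<open>Unavoidability of \<delta>: each of its colors occurs among the embeddings that
    factor through \<eta>.\<close>
  have hit: "\<exists>s\<in>Emb Y K. \<delta> (compose (univ Y) \<eta> s) = \<delta> w" if "w \<in> Emb Y K" for w
    using \<delta> \<eta> that unfolding unavoidable_coloring_def unavoidable_def by blast
  \<comment> \<open>Here \<gamma> \<lless> \<delta> enters: the recolored part stays inside the
    class of \<open>a\<close>, so every other class of \<gamma> is left intact.\<close>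
  have PD: "\<gamma> x = a" if "P x" for x
    using that le f s0 unfolding P_def a_def coloring_le_def by blast

  obtain s where s: "s \<in> Emb Y K" "\<delta> (compose (univ Y) \<eta> s) = \<delta> s0" using hit[OF s0] by blast
  then have "P (compose (univ X) \<eta> (compose (univ X) s f))"
    unfolding P_def using \<eta>Y assoc[OF f] by blast
  then have "\<epsilon> (compose (univ X) \<eta> (compose (univ X) s f)) = k" by (simp add: \<epsilon>_def)
  then have k_in: "k \<in> ?E" using Emb_compose[OF f s(1)] by force

  obtain t where t: "t \<in> Emb Y K" "\<delta> (compose (univ Y) \<eta> t) = \<delta> t0" using hit[OF t0] by blast
  define y where "y = compose (univ X) \<eta> (compose (univ X) t g)"
  have y: "y = compose (univ X) (compose (univ Y) \<eta> t) g" using assoc[OF g] by (simp add: y_def)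
  \<comment> \<open>If \<open>P y\<close> held, its witness together with
    \<open>compose (univ Y) \<eta> t\<close> would be exactly the amalgamating pair assumed not to
    exist.\<close>
  have "\<not> P y"
    using none t \<eta>Y unfolding P_def y by blast
  moreover have "\<gamma> y = a"
    using le g t t0 \<eta>Y eq unfolding a_def y coloring_le_def by metis
  ultimately have "\<epsilon> y = \<beta> a" by (simp add: \<epsilon>_def)
  then have a_in: "\<beta> a \<in> ?E" using Emb_compose[OF g t(1)] unfolding y_def by force

  \<comment> \<open>The remaining colors appear because \<gamma> is unavoidable and \<epsilon>
    agrees with \<open>\<beta> \<circ> \<gamma>\<close> outside the class of
    \<open>a\<close>.\<close>
  have "\<beta> c \<in> ?E" if c: "c \<in> \<gamma> ` Emb X K" "c \<noteq> a" for c
  proof -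
    have "unavoidable K X {s \<in> Emb X K. \<gamma> s = c}"
      using \<gamma> c(1) by (auto simp: unavoidable_coloring_def)
    then obtain x where x: "x \<in> Emb X K" "\<gamma> (compose (univ X) \<eta> x) = c"
      using \<eta> unfolding unavoidable_def by blast
    then have "\<epsilon> (compose (univ X) \<eta> x) = \<beta> c"
      using PD c(2) by (auto simp: \<epsilon>_def)
    then show ?thesis using x(1) by force
  qed
  then have "\<beta> ` \<gamma> ` Emb X K \<subseteq> ?E" using a_in by blast
  then have "{..<Suc k} \<subseteq> ?E"
    using \<beta> k_in by (auto simp: bij_betw_def less_Suc_eq)
  moreover have "?E \<subseteq> {..<Suc k}" using \<epsilon> \<eta>X by blast
  ultimately have "?E = {..<Suc k}" by (rule subset_antisym[rotated])
  then show False using card by simp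
qed

section \<open>Amalgamating two expansions of \<open>A n\<close> over \<open>A m\<close>\<close>

text \<open>Expansions correspond to colors, so an amalgamating pair \<open>s\<close>,
  \<open>t\<close> of embeddings into \<open>K\<close> with the colors of \<open>B\<close> and
  \<open>C\<close> suffices. Such a pair factors through a copy of \<open>A N\<close>, and the color
  of that copy supplies \<open>D\<close>.\<close>

lemma amalgamate_over_exhaustion:
  fixes K :: "('a, 's) fo_struct"
  assumes "Fraisse_structure L K"
    and "exhaustion K A"
    and "\<And>n. has_big_Ramsey_degree K (A n) (R n)"
    and "Roelcke_precompact (aut_group K) (pointwise_topology K)"
    and "big_Ramsey_expansion L L' K A R \<K>'"
    and mn: "m \<le> n" and f: "f \<in> Emb (A m) (A n)" and g: "g \<in> Emb (A m) (A n)"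
    and B: "B \<in> expansions_of L \<K>' (A n)" and C: "C \<in> expansions_of L \<K>' (A n)"
    and eq: "pullback (univ (A m)) B f = pullback (univ (A m)) C g"
  shows "\<exists>N. \<exists>D \<in> expansions_of L \<K>' (A N). \<exists>s \<in> Emb (A n) (A N). \<exists>t \<in> Emb (A n) (A N).
           pullback (univ (A n)) D s = B \<and> pullback (univ (A n)) D t = C \<and>
           compose (univ (A m)) s f = compose (univ (A m)) t g"
proof -
  have sub: "substructure (A i) K" "finite (univ (A i))" for i
    using assms(2) by (auto simp: exhaustion_def)
  obtain F where F: "finite F" "F \<subseteq> Aut K"
    and pairs: "\<And>s t. s \<in> Emb (A n) K \<Longrightarrow> t \<in> Emb (A n) K \<Longrightarrow>
       \<exists>k \<in> Aut K. \<exists>\<phi> \<in> F. \<forall>x \<in> univ (A n). s x = k x \<and> t x = k (\<phi> x)"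
    using Roelcke_precompact_pairs[OF assms(1,4) sub] by blast
  have subK: "univ (A n) \<subseteq> univ K" using sub by (simp add: substructure_def)
  then have "(\<Union>\<phi>\<in>F. \<phi> ` univ (A n)) \<subseteq> univ K"
    using F(2) by (auto simp: Aut_def)
  \<comment> \<open>\<open>N\<close> has to be fixed before \<open>s\<close> and \<open>t\<close>
    are known, since the colorings are given only for the levels below a chosen \<open>r\<close>.
    Finiteness of \<open>F\<close> makes this possible, and \<open>r = Suc N\<close> includes level
    \<open>N\<close>.\<close>
  then obtain N where N: "N \<ge> n" "(\<Union>\<phi>\<in>F. \<phi> ` univ (A n)) \<subseteq> univ (A N)"
    using exhaustion_finite_subset[OF assms(2)] F(1) sub(2) by (metis finite_UN finite_imageI)
  obtain \<gamma> :: "nat \<Rightarrow> ('a \<Rightarrow> 'a) \<Rightarrow> nat" and \<sigma> :: "nat \<Rightarrow> nat \<Rightarrow> ('a, 's) fo_struct" where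
    un: "\<forall>i < Suc N. unavoidable_coloring K (A i) (R i) (\<gamma> i)" and
    le: "\<forall>j < Suc N. \<forall>i \<le> j. coloring_le K (A i) (A j) (\<gamma> i) (\<gamma> j)" and
    \<sigma>: "\<forall>i < Suc N. bij_betw (\<sigma> i) (\<gamma> i ` Emb (A i) K) (expansions_of L \<K>' (A i))" and
    nat: "\<forall>j < Suc N. \<forall>i \<le> j. \<forall>s \<in> Emb (A j) K. \<forall>f \<in> Emb (A i) (A j).
           \<sigma> i (\<gamma> i (compose (univ (A i)) s f)) = pullback (univ (A i)) (\<sigma> j (\<gamma> j s)) f"
    using assms(5)[unfolded big_Ramsey_expansion_def, THEN conjunct2, THEN conjunct2,
        THEN conjunct2, THEN spec, of "Suc N"]
    by (elim exE conjE) (rule that; assumption)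
  have n: "n < Suc N" and m: "m < Suc N" using N(1) mn by auto
  have \<sigma>n: "\<sigma> n ` \<gamma> n ` Emb (A n) K = expansions_of L \<K>' (A n)"
    using \<sigma> n by (auto simp: bij_betw_def)
  obtain s0 t0 where s0: "s0 \<in> Emb (A n) K" "\<sigma> n (\<gamma> n s0) = B"
    and t0: "t0 \<in> Emb (A n) K" "\<sigma> n (\<gamma> n t0) = C"
    using B C unfolding \<sigma>n[symmetric] by auto
  \<comment> \<open>The equal pullbacks to \<open>A m\<close> become equal colors: compatibility of
    \<sigma> with restriction gives equal images, and \<sigma> is injective at level
    \<open>m\<close>.\<close>
  have "\<sigma> m (\<gamma> m (compose (univ (A m)) s0 f)) = \<sigma> m (\<gamma> m (compose (univ (A m)) t0 g))"
    using nat n mn f g s0 t0 eq by metis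
  moreover have "compose (univ (A m)) s0 f \<in> Emb (A m) K" "compose (univ (A m)) t0 g \<in> Emb (A m) K"
    using Emb_compose f g s0 t0 by blast+
  ultimately have eq': "\<gamma> m (compose (univ (A m)) s0 f) = \<gamma> m (compose (univ (A m)) t0 g)"
    using \<sigma> m unfolding bij_betw_def inj_on_def by blast
  have "big_Ramsey_bound K (A m) (R m)"
    using assms(3) by (simp add: has_big_Ramsey_degree_def)
  then obtain s t where s: "s \<in> Emb (A n) K" "\<gamma> n s = \<gamma> n s0"
    and t: "t \<in> Emb (A n) K" "\<gamma> n t = \<gamma> n t0"
    and st: "compose (univ (A m)) s f = compose (univ (A m)) t g"
    using unavoidable_colors_amalgamate[OF _ _ _ _ f g s0(1) t0(1) eq'] un le n m mn by metis
  obtain k \<phi> where k: "k \<in> Aut K" and \<phi>: "\<phi> \<in> F"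
    and k\<phi>: "\<And>x. x \<in> univ (A n) \<Longrightarrow> s x = k x \<and> t x = k (\<phi> x)"
    using pairs[OF s(1) t(1)] by blast
  \<comment> \<open>The common factor: \<open>s = h \<circ> s'\<close> and
    \<open>t = h \<circ> t'\<close>, where \<open>s'\<close> is the inclusion and \<open>t'\<close>
    is \<phi>, both landing in \<open>A N\<close> by the choice of \<open>N\<close>.\<close>
  define h where "h = restrict k (univ (A N))"
  define s' where "s' = (\<lambda>x\<in>univ (A n). x)"
  define t' where "t' = restrict \<phi> (univ (A n))"
  have h: "h \<in> Emb (A N) K"
    unfolding h_def using k sub(1) by (intro Emb_restrict) (auto simp: Aut_def)
  have nN: "substructure (A n) (A N)" by (rule exhaustion_mono[OF assms(2) N(1)])
  have s': "s' \<in> Emb (A n) (A N)"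
    unfolding s'_def by (rule Emb_substructure_trans[OF Emb_id nN])
  have "t' \<in> Emb (A n) K"
    unfolding t'_def using \<phi> F(2) sub(1) by (intro Emb_restrict) (auto simp: Aut_def)
  then have t': "t' \<in> Emb (A n) (A N)"
    using N(2) \<phi> by (intro Emb_corestrict[OF _ sub(1)]) (auto simp: t'_def)
  have st_ext: "s \<in> extensional (univ (A n))" "t \<in> extensional (univ (A n))"
    using s(1) t(1) by (auto simp: Emb_def PiE_def)
  have \<phi>_in: "\<phi> x \<in> univ (A N)" if "x \<in> univ (A n)" for x
    using N(2) \<phi> that by blast
  have hs: "compose (univ (A n)) h s' = s"
    using nN k\<phi> st_ext(1) by (intro ext)
      (auto simp: compose_def h_def s'_def substructure_def extensional_def subset_iff)
  have ht: "compose (univ (A n)) h t' = t"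
    using \<phi>_in k\<phi> st_ext(2) by (intro ext)
      (auto simp: compose_def h_def t'_def extensional_def)
  \<comment> \<open>\<open>D\<close> is the expansion of \<open>A N\<close> coded by the color of
    \<open>h\<close>, so its pullbacks along \<open>s'\<close> and \<open>t'\<close> are coded by
    the colors of \<open>s\<close> and \<open>t\<close>.\<close>
  define D where "D = \<sigma> N (\<gamma> N h)"
  have "D \<in> expansions_of L \<K>' (A N)"
    using \<sigma> h unfolding D_def by (auto simp: bij_betw_def)
  moreover have "pullback (univ (A n)) D s' = B" "pullback (univ (A n)) D t' = C"
    using nat N(1) h s' t' hs ht s s0 t t0 unfolding D_def by (metis lessI)+
  \<comment> \<open>Injectivity of \<open>h\<close> cancels it from
    \<open>s \<circ> f = t \<circ> g\<close>.\<close>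
  moreover have "compose (univ (A m)) s' f = compose (univ (A m)) t' g"
  proof -
    have "inj_on h (univ (A N))" using h by (simp add: Emb_def)
    moreover have "h (s' (f x)) = h (t' (g x))" "s' (f x) \<in> univ (A N)" "t' (g x) \<in> univ (A N)"
      if "x \<in> univ (A m)" for x
    proof -
      have fg: "f x \<in> univ (A n)" "g x \<in> univ (A n)"
        using f g that by (auto simp: Emb_def)
      then show "s' (f x) \<in> univ (A N)" "t' (g x) \<in> univ (A N)"
        using s' t' by (auto simp: Emb_def)
      have "s (f x) = t (g x)"
        using fun_cong[OF st, of x] that by (simp add: compose_def)
      then show "h (s' (f x)) = h (t' (g x))"
        using fg fun_cong[OF hs, of "f x"] fun_cong[OF ht, of "g x"] by (simp add: compose_def)
    qed
    ultimately show ?thesis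
      by (intro ext) (auto simp: compose_def inj_on_def)
  qed
  ultimately show ?thesis
    using s' t' by blast
qed

section \<open>Transfer to arbitrary members of the expansion class\<close>

text \<open>Upgrades an embedding of reducts to one of the expanded structures, once the expansion
  downstairs is known to be the pullback.\<close>

lemma pullback_expansion_Emb:
  assumes "B \<in> expansions_of L \<K>' X" "D \<in> expansions_of L \<K>' Y"
    and "s \<in> Emb X Y" "pullback (univ X) D s = B"
  shows "s \<in> Emb B D"
proof -
  have "univ B = univ X" "univ D = univ Y"
    using assms(1,2) by (auto simp: expansions_of_def reduct_def)
  then show ?thesis
    using assms(3,4) by (intro Emb_pullback) (auto simp: Emb_def)
qed

theorem theorem7p17:
  fixes L L' :: "'s language"
    and K :: "('a, 's) fo_struct"
    and A :: "nat \<Rightarrow> ('a, 's) fo_struct"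
    and R :: "nat \<Rightarrow> nat"
    and \<K>' :: "('a, 's) fo_struct set"
  assumes "Fraisse_structure L K"
    and "exhaustion K A"
    and "\<And>n. has_big_Ramsey_degree K (A n) (R n)"
    and "Roelcke_precompact (aut_group K) (pointwise_topology K)"
    and "big_Ramsey_expansion L L' K A R \<K>'"
  shows "amalgamation_property \<K>'"
  unfolding amalgamation_property_def
proof (intro ballI)
  fix X B C f g
  assume X: "X \<in> \<K>'" and B: "B \<in> \<K>'" and C: "C \<in> \<K>'"
    and f: "f \<in> Emb X B" and g: "g \<in> Emb X C"
  have str: "is_structure L' Y" "reduct L Y \<in> iso_closure L A" if "Y \<in> \<K>'" for Y
    using that assms(5) by (auto simp: big_Ramsey_expansion_def expansion_class_def)
  \<comment> \<open>Surjectivity of the pullback map, applied to \<open>Y\<close> as an expansion of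
    its own reduct, carries \<open>Y\<close> up along \<open>e\<close>.\<close>
  have reasonable: "\<exists>Y'\<in>expansions_of L \<K>' Z. pullback (univ Y) Y' e = Y"
    if "Y \<in> \<K>'" "Z \<in> iso_closure L A" "e \<in> Emb (reduct L Y) Z" for Y Z e
  proof -
    have "Y \<in> expansions_of L \<K>' (reduct L Y)" using that(1) by (simp add: expansions_of_def)
    moreover have "univ (reduct L Y) = univ Y" by (simp add: reduct_def)
    ultimately show ?thesis
      using assms(5) that str(2)[OF that(1)]
      unfolding big_Ramsey_expansion_def reasonable_expansion_def by (metis (no_types, lifting) imageE)
  qed
  have A_in: "A n \<in> iso_closure L A" for n
    using assms(1,2) by (intro substructure_in_iso_closure) (auto simp: Fraisse_structure_def)
  have univ_red: "univ (reduct L Y) = univ Y" for Y :: "('a, 's) fo_struct"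
    by (simp add: reduct_def)
  \<comment> \<open>Surjectivity of \<open>i\<close> is kept because its inverse \<open>j\<close> is
    what moves the base \<open>X\<close> to \<open>A m\<close>.\<close>
  obtain m i where i: "i \<in> Emb (reduct L X) (A m)" "i ` univ X = univ (A m)"
    using str(2)[OF X] univ_red by (auto simp: iso_closure_def isomorphic_def)
  obtain p b where b: "b \<in> Emb (reduct L B) (A p)"
    using str(2)[OF B] by (auto simp: iso_closure_def isomorphic_def)
  obtain q c where c: "c \<in> Emb (reduct L C) (A q)"
    using str(2)[OF C] by (auto simp: iso_closure_def isomorphic_def)
  \<comment> \<open>A common level for \<open>B\<close> and \<open>C\<close>; including
    \<open>m\<close> ensures \<open>m \<le> n\<close>.\<close>
  define n where "n = max m (max p q)"
  have b: "b \<in> Emb (reduct L B) (A n)" and c: "c \<in> Emb (reduct L C) (A n)"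
    using Emb_substructure_trans[OF b exhaustion_mono[OF assms(2)]]
      Emb_substructure_trans[OF c exhaustion_mono[OF assms(2)]] by (auto simp: n_def)
  obtain B1 where B1: "B1 \<in> expansions_of L \<K>' (A n)" "pullback (univ B) B1 b = B"
    using reasonable[OF B A_in b] by blast
  obtain C1 where C1: "C1 \<in> expansions_of L \<K>' (A n)" "pullback (univ C) C1 c = C"
    using reasonable[OF C A_in c] by blast
  define j where "j = restrict (inv_into (univ X) i) (univ (A m))"
  have j: "j \<in> Emb (A m) (reduct L X)"
    using Emb_inv[OF i(1)] i(2) by (simp add: j_def univ_red)
  have j_fun: "j \<in> univ (A m) \<rightarrow> univ X"
    using j by (auto simp: Emb_def univ_red)
  have f_fun: "f \<in> univ X \<rightarrow> univ B" and g_fun: "g \<in> univ X \<rightarrow> univ C"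
    using f g by (auto simp: Emb_def)
  define f1 where "f1 = compose (univ (A m)) (compose (univ X) b f) j"
  define g1 where "g1 = compose (univ (A m)) (compose (univ X) c g) j"
  have f1: "f1 \<in> Emb (A m) (A n)" and g1: "g1 \<in> Emb (A m) (A n)"
    using Emb_compose[OF j Emb_compose[OF Emb_reduct[OF f] b]]
      Emb_compose[OF j Emb_compose[OF Emb_reduct[OF g] c]]
    by (simp_all add: f1_def g1_def univ_red)
  \<comment> \<open>Pulling \<open>B1\<close> back along \<open>b\<close>, then \<open>f\<close>,
    then \<open>j\<close> passes through \<open>B\<close> and \<open>X\<close>. The same computation
    for \<open>C1\<close> ends at the same structure, so the two expansions agree over
    \<open>A m\<close>.\<close>
  have "pullback (univ (A m)) B1 f1 = pullback (univ (A m)) X j"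
    using pullback_Emb_eq[OF str(1)[OF X] f] B1(2)
    unfolding f1_def by (simp flip: pullback_compose[OF j_fun] pullback_compose[OF f_fun])
  moreover have "pullback (univ (A m)) C1 g1 = pullback (univ (A m)) X j"
    using pullback_Emb_eq[OF str(1)[OF X] g] C1(2)
    unfolding g1_def by (simp flip: pullback_compose[OF j_fun] pullback_compose[OF g_fun])
  ultimately have "pullback (univ (A m)) B1 f1 = pullback (univ (A m)) C1 g1" by simp
  moreover have "m \<le> n" by (simp add: n_def)
  ultimately obtain N D s t where D: "D \<in> expansions_of L \<K>' (A N)"
    and s: "s \<in> Emb (A n) (A N)" "pullback (univ (A n)) D s = B1"
    and t: "t \<in> Emb (A n) (A N)" "pullback (univ (A n)) D t = C1"
    and st: "compose (univ (A m)) s f1 = compose (univ (A m)) t g1"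
    using amalgamate_over_exhaustion[OF assms _ f1 g1 B1(1) C1(1)] by blast
  have "b \<in> Emb B B1" "c \<in> Emb C C1"
    using pullback_expansion_Emb[of B L \<K>' "reduct L B" B1 "A n" b] B B1 b
      pullback_expansion_Emb[of C L \<K>' "reduct L C" C1 "A n" c] C C1 c
    by (auto simp: expansions_of_def univ_red)
  moreover have "s \<in> Emb B1 D" "t \<in> Emb C1 D"
    using pullback_expansion_Emb B1 C1 D s t by blast+
  ultimately have rs: "compose (univ B) s b \<in> Emb B D" "compose (univ C) t c \<in> Emb C D"
    by (simp_all add: Emb_compose)
  \<comment> \<open>Evaluating the identity over \<open>A m\<close> at \<open>i x\<close> cancels
    \<open>j\<close>.\<close>
  have "s (b (f x)) = t (c (g x))" if x: "x \<in> univ X" for x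
  proof -
    have "inj_on i (univ X)" using i(1) by (simp add: Emb_def univ_red)
    then have "i x \<in> univ (A m)" "j (i x) = x"
      using x i(2) by (auto simp: j_def)
    then show ?thesis
      using x fun_cong[OF st, of "i x"] by (simp add: compose_def f1_def g1_def)
  qed
  then have "compose (univ X) (compose (univ B) s b) f = compose (univ X) (compose (univ C) t c) g"
    using f_fun g_fun by (intro ext) (auto simp: compose_def)
  then show "\<exists>D\<in>\<K>'. \<exists>r\<in>Emb B D. \<exists>s\<in>Emb C D. compose (univ X) r f = compose (univ X) s g"
    using D rs by (auto simp: expansions_of_def)
qed

end
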